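(* Let $k\ge 2$. When viewed as a cubical complex, the poset $\mathcal{P}_k$ of disjoint supports on $k$ elements is homeomorphic to the real projective space $\mathbb{RP}^{k-2}$.
   Context: Write $[k]=\{1,\ldots,k\}$. The poset of disjoint supports on $k$ elements $(\mathcal{P}_k,\preceq)$ has as ground set the unordered pairs $\{I,J\}$ where $I,J\subseteq[k]$ are nonempty, proper, disjoint subsets, together with a unique minimum element $\hat 0$; the order on pairs is $\{R,T\}\preceq\{I,J\}$ if and only if, up to swapping the names of $R$ and $T$, $R\supseteq I$ and $T\supseteq J$. For each $\{I,J\}$ the principal ideal $\{X\in\mathcal{P}_k : X\preceq\{I,J\}\}$ is isomorphic to the face lattice of a cube of dimension $k-|I|-|J|$ (with $\hat 0$ corresponding to the empty face). Viewing $\mathcal{P}_k$ as a cubical complex means taking the topological space obtained by gluing these cubes together along faces as dictated by coincidences of principal ideals in $\mathcal{P}_k$. Explicitly: for each element $\{I,J\}\neq\hat 0$ choose an ordering $(I,J)$ and let $C_{(I,J)}=\{x\in[0,1]^k : x_i=0 \text{ for } i\in I,\ x_j=1\text{ for } j\in J\}$; the space is the quotient of the disjoint union of all these cubes by the equivalence relation generated by the following identifications, for each $\{R,T\}\preceq\{I,J\}$ with chosen orderings $(R,T)$ and $(I,J)$: a point $x\in C_{(R,T)}$ is identified with the point $x\in C_{(I,J)}$ if $R\supseteq I$ and $T\supseteq J$, and with the point $(1-x_1,\ldots,1-x_k)\in C_{(I,J)}$ if $R\supseteq J$ and $T\supseteq I$. (The result does not depend, up to homeomorphism, on the chosen orderings.)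 $\mathbb{RP}^0$ is a point. *)

theory Defs
  imports "HOL-Analysis.Analysis"
begin

section \<open>Quotient topologies\<close>

text \<open>
  The points of the quotient are the classes in \<open>topspace X // R\<close>. The definition is meant for an
  equivalence relation \<open>R\<close> on \<open>topspace X\<close>; only then is the predicate below known to be a topology.
\<close>

definition quotient_topology :: "'a topology \<Rightarrow> ('a \<times> 'a) set \<Rightarrow> 'a set topology" where
  "quotient_topology X R = topology (\<lambda>U. U \<subseteq> topspace X // R \<and> openin X (\<Union>U))"

lemma openin_quotient_topology:
  assumes "equiv (topspace X) R"
  shows "openin (quotient_topology X R) U \<longleftrightarrow> U \<subseteq> topspace X // R \<and> openin X (\<Union>U)"
proof -
  have "istopology (\<lambda>U. U \<subseteq> topspace X // R \<and> openin X (\<Union>U))"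
    unfolding istopology_def
  proof (intro conjI allI impI)
    fix S T
    assume S: "S \<subseteq> topspace X // R \<and> openin X (\<Union>S)" and T: "T \<subseteq> topspace X // R \<and> openin X (\<Union>T)"
    have "\<Union>(S \<inter> T) = \<Union>S \<inter> \<Union>T"
    proof
      show "\<Union>S \<inter> \<Union>T \<subseteq> \<Union>(S \<inter> T)"
      proof
        fix x assume "x \<in> \<Union>S \<inter> \<Union>T"
        then obtain A B where AB: "A \<in> S" "B \<in> T" "x \<in> A" "x \<in> B" by blast
        with S T quotient_disj[OF assms, of A B] have "A = B" by blast
        with AB show "x \<in> \<Union>(S \<inter> T)" by blast
      qed
    qed blast
    with S T show "openin X (\<Union>(S \<inter> T))" by (simp add: openin_Int)
    from S show "S \<inter> T \<subseteq> topspace X // R" by blast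
  next
    fix K assume K: "\<forall>S\<in>K. S \<subseteq> topspace X // R \<and> openin X (\<Union>S)"
    then show "\<Union>K \<subseteq> topspace X // R" by blast
    have "\<Union>(\<Union>K) = \<Union>(Union ` K)" by blast
    with K show "openin X (\<Union>(\<Union>K))" by auto
  qed
  then show ?thesis
    by (simp add: quotient_topology_def topology_inverse')
qed

lemma topspace_quotient_topology:
  assumes "equiv (topspace X) R"
  shows "topspace (quotient_topology X R) = topspace X // R"
proof -
  have "openin (quotient_topology X R) (topspace X // R)"
    by (simp add: openin_quotient_topology[OF assms] Union_quotient[OF assms])
  moreover have "U \<subseteq> topspace X // R" if "openin (quotient_topology X R) U" for U
    using that by (simp add: openin_quotient_topology[OF assms])
  ultimately show ?thesis
    by (meson openin_subset openin_topspace subset_antisym)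
qed

lemma quotient_map_quotient_topology:
  assumes "equiv (topspace X) R"
  shows "quotient_map X (quotient_topology X R) (\<lambda>x. R `` {x})"
  unfolding quotient_map_def topspace_quotient_topology[OF assms]
proof (intro conjI allI impI)
  show "(\<lambda>x. R `` {x}) ` topspace X = topspace X // R"
    by (auto simp: quotient_def)
  fix U assume U: "U \<subseteq> topspace X // R"
  have "{x \<in> topspace X. R `` {x} \<in> U} = \<Union>U"
  proof (intro set_eqI iffI)
    fix x assume "x \<in> {x \<in> topspace X. R `` {x} \<in> U}"
    then show "x \<in> \<Union>U" using equiv_class_self[OF assms] by blast
  next
    fix x assume "x \<in> \<Union>U"
    then obtain A where A: "A \<in> U" "x \<in> A" by blast
    then obtain a where a: "a \<in> topspace X" "A = R `` {a}"
      using U by (auto simp: quotient_def)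
    then have "R `` {x} = A"
      using A equiv_class_eq[OF assms] by blast
    moreover have "x \<in> topspace X"
      using A U Union_quotient[OF assms] by blast
    ultimately show "x \<in> {x \<in> topspace X. R `` {x} \<in> U}" using A by simp
  qed
  then show "openin X {x \<in> topspace X. R `` {x} \<in> U} \<longleftrightarrow> openin (quotient_topology X R) U"
    using U by (simp add: openin_quotient_topology[OF assms])
qed

definition generated_equiv :: "'a set \<Rightarrow> ('a \<Rightarrow> 'a \<Rightarrow> bool) \<Rightarrow> ('a \<times> 'a) set" where
  "generated_equiv A r = {(x, y). x \<in> A \<and> y \<in> A \<and> equivclp (\<lambda>a b. a \<in> A \<and> b \<in> A \<and> r a b) x y}"

lemma equiv_generated_equiv: "equiv A (generated_equiv A r)"
  unfolding generated_equiv_def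
  by (rule equivI) (auto intro!: refl_onI symI transI intro: equivclp_sym equivclp_trans)


section \<open>Real projective space\<close>

text \<open>\<open>nsphere n\<close> is the unit sphere in the coordinates \<open>0, \<dots>, n\<close>, so it has dimension \<open>n\<close>.\<close>

definition antipodal_rel :: "nat \<Rightarrow> ((nat \<Rightarrow> real) \<times> (nat \<Rightarrow> real)) set" where
  "antipodal_rel n = {(x, y). x \<in> topspace (nsphere n) \<and> y \<in> topspace (nsphere n) \<and>
                              (y = x \<or> y = (\<lambda>i. - x i))}"

lemma equiv_antipodal_rel: "equiv (topspace (nsphere n)) (antipodal_rel n)"
  unfolding antipodal_rel_def
  by (rule equivI) (auto intro!: refl_onI symI transI)

definition real_projective_space :: "nat \<Rightarrow> (nat \<Rightarrow> real) set topology" where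
  "real_projective_space n = quotient_topology (nsphere n) (antipodal_rel n)"


section \<open>The poset of disjoint supports\<close>

text \<open>\<open>None\<close> is the minimum element; \<open>Some {I, J}\<close> is the unordered pair.\<close>

definition disjoint_supports :: "nat \<Rightarrow> nat set set option set" where
  "disjoint_supports k = insert None
     {Some {I, J} | I J. I \<noteq> {} \<and> J \<noteq> {} \<and> I \<subset> {1..k} \<and> J \<subset> {1..k} \<and> I \<inter> J = {}}"

text \<open>
  Both \<open>{R, T}\<close> and \<open>{I, J}\<close> are unordered, so the existential quantifiers already allow for swapping
  the names.
\<close>

definition supports_le :: "nat set set option \<Rightarrow> nat set set option \<Rightarrow> bool" (infix \<open>\<preceq>\<close> 50) where
  "X \<preceq> Y \<longleftrightarrow>
     X = None \<or> (\<exists>R T I J. X = Some {R, T} \<and> Y = Some {I, J} \<and> I \<subseteq> R \<and> J \<subseteq> T)"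


section \<open>The associated cubical complex\<close>

definition is_ordering :: "nat \<Rightarrow> (nat set set option \<Rightarrow> nat set \<times> nat set) \<Rightarrow> bool" where
  "is_ordering k c \<longleftrightarrow> (\<forall>X \<in> disjoint_supports k - {None}. X = Some {fst (c X), snd (c X)})"

definition cube_topology :: "nat \<Rightarrow> (nat \<Rightarrow> real) topology" where
  "cube_topology k = product_topology (\<lambda>_. top_of_set {0..1}) {1..k}"

fun cube_face :: "nat \<Rightarrow> nat set \<times> nat set \<Rightarrow> (nat \<Rightarrow> real) set" where
  "cube_face k (I, J) = {x \<in> topspace (cube_topology k). (\<forall>i\<in>I. x i = 0) \<and> (\<forall>j\<in>J. x j = 1)}"

definition cube_reflect :: "nat \<Rightarrow> (nat \<Rightarrow> real) \<Rightarrow> nat \<Rightarrow> real" where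
  "cube_reflect k x = (\<lambda>i\<in>{1..k}. 1 - x i)"

definition disjoint_cubes ::
  "nat \<Rightarrow> (nat set set option \<Rightarrow> nat set \<times> nat set) \<Rightarrow>
   (nat set set option \<times> (nat \<Rightarrow> real)) topology" where
  "disjoint_cubes k c =
     sum_topology (\<lambda>X. subtopology (cube_topology k) (cube_face k (c X))) (disjoint_supports k - {None})"

inductive glue ::
  "nat \<Rightarrow> (nat set set option \<Rightarrow> nat set \<times> nat set) \<Rightarrow>
   nat set set option \<times> (nat \<Rightarrow> real) \<Rightarrow> nat set set option \<times> (nat \<Rightarrow> real) \<Rightarrow> bool"
  for k c where
  same: "\<lbrakk>X \<in> disjoint_supports k - {None}; Y \<in> disjoint_supports k - {None}; X \<preceq> Y;
          c X = (R, T); c Y = (I, J); I \<subseteq> R; J \<subseteq> T; x \<in> cube_face k (R, T)\<rbrakk>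
         \<Longrightarrow> glue k c (X, x) (Y, x)"
| swap: "\<lbrakk>X \<in> disjoint_supports k - {None}; Y \<in> disjoint_supports k - {None}; X \<preceq> Y;
          c X = (R, T); c Y = (I, J); J \<subseteq> R; I \<subseteq> T; x \<in> cube_face k (R, T)\<rbrakk>
         \<Longrightarrow> glue k c (X, x) (Y, cube_reflect k x)"

definition disjoint_supports_space ::
  "nat \<Rightarrow> (nat set set option \<Rightarrow> nat set \<times> nat set) \<Rightarrow>
   (nat set set option \<times> (nat \<Rightarrow> real)) set topology" where
  "disjoint_supports_space k c =
     quotient_topology (disjoint_cubes k c)
       (generated_equiv (topspace (disjoint_cubes k c)) (glue k c))"

lemma is_ordering_exists: "\<exists>c. is_ordering k c"
proof -
  have "\<exists>p. X = Some {fst p, snd p}" if X: "X \<in> disjoint_supports k - {None}" for X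
  proof -
    obtain I J where "X = Some {I, J}"
      using X unfolding disjoint_supports_def by blast
    then have "X = Some {fst (I, J), snd (I, J)}" by simp
    then show ?thesis ..
  qed
  then show ?thesis unfolding is_ordering_def
    by (intro exI[of _ "\<lambda>X. SOME p. X = Some {fst p, snd p}"] ballI) (rule someI_ex)
qed

lemma is_ordering_subset:
  assumes "is_ordering k c" "X \<in> disjoint_supports k - {None}" "c X = (I, J)"
  shows "I \<subseteq> {1..k}" "J \<subseteq> {1..k}"
proof -
  have "X = Some {I, J}"
    using assms(1)[unfolded is_ordering_def, rule_format, OF assms(2)] assms(3) by simp
  moreover obtain I' J' where "X = Some {I', J'}" "I' \<subseteq> {1..k}" "J' \<subseteq> {1..k}"
    using assms(2) unfolding disjoint_supports_def by blast
  ultimately show "I \<subseteq> {1..k}" "J \<subseteq> {1..k}"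
    by (metis doubleton_eq_iff option.inject)+
qed

text \<open>
  Hence restricting the gluing relation to the disjoint union of the cubes, as
  \<open>generated_equiv\<close> does, discards no identification.
\<close>

lemma glue_in_topspace:
  assumes c: "is_ordering k c" and "glue k c a b"
  shows "a \<in> topspace (disjoint_cubes k c) \<and> b \<in> topspace (disjoint_cubes k c)"
  using assms(2)
proof cases
  case (same X Y R T I J x)
  then show ?thesis
    by (auto simp: disjoint_cubes_def cube_topology_def PiE_iff)
next
  case (swap X Y R T I J x)
  have "I \<subseteq> {1..k}" "J \<subseteq> {1..k}"
    using is_ordering_subset[OF c, of Y I J] swap by auto
  then have "cube_reflect k x \<in> cube_face k (I, J)"
    using swap by (auto simp: cube_topology_def cube_reflect_def PiE_iff)
  with swap show ?thesis
    by (auto simp: disjoint_cubes_def)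
qed

end

theory Submission
  imports Defs
begin

text \<open>
  Let \<open>B\<close> be the set of points of the cube \<open>[0,1]^k\<close> with minimal coordinate \<open>0\<close> and maximal
  coordinate \<open>1\<close>. Every cube of the complex lies in \<open>B\<close>, and a point \<open>x \<in> B\<close> together with its
  reflection \<open>1 - x\<close> lies in the relative interior of exactly one cube, that of the pair of its zero
  set and its one set; hence the glued space is \<open>B\<close> modulo \<open>x \<sim> 1 - x\<close>. Modulo translation along
  \<open>(1, \<dots>, 1)\<close>, every nonconstant vector has a unique positive multiple that is represented in \<open>B\<close>.
  So recording the differences \<open>x\<^sub>i - x\<^sub>k\<close> for \<open>i < k\<close> and normalising them identifies \<open>B\<close> with the
  unit sphere of \<open>\<real>^(k-1)\<close>, and turns \<open>x \<mapsto> 1 - x\<close> into the antipodal map.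
\<close>

section \<open>General facts on quotient maps and sum topologies\<close>

text \<open>Since \<open>g\<close> is constant on the fibres of \<open>f\<close>, it descends to a
  continuous \<open>h\<close> on \<open>Y\<close>. This \<open>h\<close> inherits the quotient
  property from \<open>g\<close>, and it is injective because \<open>f\<close> and \<open>g\<close>
  identify the same points; an injective quotient map is a homeomorphism.\<close>

lemma quotient_maps_same_fibres_imp_homeomorphic_space:
  assumes f: "quotient_map X Y f" and g: "quotient_map X Z g"
    and fg: "\<And>x y. \<lbrakk>x \<in> topspace X; y \<in> topspace X\<rbrakk> \<Longrightarrow> f x = f y \<longleftrightarrow> g x = g y"
  shows "Y homeomorphic_space Z"
proof -
  obtain h where h: "continuous_map Y Z h" "\<And>x. x \<in> topspace X \<Longrightarrow> h (f x) = g x"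
    using quotient_map_lift_exists[OF f quotient_imp_continuous_map[OF g]] fg by metis
  have "quotient_map X Z (h \<circ> f)"
    using g by (rule quotient_map_eq) (simp add: h(2))
  then have "quotient_map Y Z h"
    using quotient_map_compose_eq[OF f] by blast
  moreover have "inj_on h (topspace Y)"
    unfolding quotient_imp_surjective_map[OF f, symmetric]
    by (auto simp: inj_on_def h(2) fg)
  ultimately have "homeomorphic_map Y Z h"
    by (simp add: homeomorphic_map_def)
  then show ?thesis
    by (rule homeomorphic_map_imp_homeomorphic_space)
qed

lemma compact_space_sum_topology:
  assumes "finite I" "\<And>i. i \<in> I \<Longrightarrow> compact_space (X i)"
  shows "compact_space (sum_topology X I)"
proof -
  have "compactin (sum_topology X I) (Pair i ` topspace (X i))" if "i \<in> I" for i
    using assms(2)[OF that] continuous_map_component_injection[OF that]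
    by (auto simp: compact_space_def intro: image_compactin)
  then have "compactin (sum_topology X I) (\<Union>i\<in>I. Pair i ` topspace (X i))"
    using assms(1) by (auto intro!: compactin_Union)
  moreover have "(\<Union>i\<in>I. Pair i ` topspace (X i)) = topspace (sum_topology X I)"
    by auto
  ultimately show ?thesis
    by (simp add: compact_space_def)
qed

lemma continuous_map_from_sum_topology:
  assumes "\<And>i. i \<in> I \<Longrightarrow> continuous_map (X i) Y (\<lambda>x. f (i, x))"
  shows "continuous_map (sum_topology X I) Y f"
proof -
  have "f p \<in> topspace Y" if "p \<in> Sigma I (topspace \<circ> X)" for p
    using assms that by (auto simp: continuous_map_def Pi_iff)
  moreover have "openin (sum_topology X I) {p \<in> Sigma I (topspace \<circ> X). f p \<in> U}"
    if "openin Y U" for U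
    unfolding openin_sum_topology
    using openin_continuous_map_preimage[OF assms that] by (auto simp: o_def)
  ultimately show ?thesis
    by (auto simp: continuous_map_def)
qed


section \<open>The antipodal quotient\<close>

lemma nsphere_uminus:
  "x \<in> topspace (nsphere n) \<Longrightarrow> (\<lambda>i. - x i) \<in> topspace (nsphere n)"
  by (simp add: nsphere)

lemma continuous_map_nsphere_uminus:
  "continuous_map (nsphere n) (nsphere n) (\<lambda>x i. - x i)"
proof -
  have "continuous_map (nsphere n) (powertop_real UNIV) (\<lambda>x i. - x i)"
    by (auto simp: continuous_map_componentwise_UNIV
        intro: continuous_map_minus continuous_map_nsphere_projection)
  then show ?thesis
    using nsphere_uminus by (auto simp: nsphere continuous_map_in_subtopology)
qed

lemma antipodal_class_eq_iff:
  assumes "x \<in> topspace (nsphere n)" "y \<in> topspace (nsphere n)"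
  shows "antipodal_rel n `` {x} = antipodal_rel n `` {y} \<longleftrightarrow> y = x \<or> y = (\<lambda>i. - x i)"
  using eq_equiv_class_iff[OF equiv_antipodal_rel assms] assms
  by (simp add: antipodal_rel_def)

text \<open>The saturation of a closed set \<open>C\<close> is the union of \<open>C\<close> and its
  preimage under the antipodal map, hence closed; in a quotient this says that the image of
  \<open>C\<close> is closed.\<close>

lemma closed_map_antipodal:
  "closed_map (nsphere n) (real_projective_space n) (\<lambda>x. antipodal_rel n `` {x})"
    (is "closed_map ?S ?P ?q")
  unfolding closed_map_def
proof (intro allI impI)
  fix C assume C: "closedin ?S C"
  have q: "quotient_map ?S ?P ?q"
    unfolding real_projective_space_def
    by (rule quotient_map_quotient_topology[OF equiv_antipodal_rel])
  have CS: "C \<subseteq> topspace ?S"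
    using C by (rule closedin_subset)
  have "{x \<in> topspace ?S. ?q x \<in> ?q ` C} = C \<union> {x \<in> topspace ?S. (\<lambda>i. - x i) \<in> C}"
    using CS by (auto simp: image_iff antipodal_class_eq_iff subset_iff)
  moreover have "closedin ?S {x \<in> topspace ?S. (\<lambda>i. - x i) \<in> C}"
    using continuous_map_nsphere_uminus C by (rule closedin_continuous_map_preimage)
  ultimately have "closedin ?S {x \<in> topspace ?S. ?q x \<in> ?q ` C}"
    using closedin_Un[OF C] by simp
  moreover have "?q ` C \<subseteq> topspace ?P"
    using CS quotient_imp_surjective_map[OF q] by blast
  ultimately show "closedin ?P (?q ` C)"
    using q unfolding quotient_map_closedin by blast
qed


section \<open>Points of the cube with minimum zero and maximum one\<close>

definition cube_rim :: "nat \<Rightarrow> (nat \<Rightarrow> real) set" where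
  "cube_rim k = {x \<in> topspace (cube_topology k). (\<exists>i\<in>{1..k}. x i = 0) \<and> (\<exists>j\<in>{1..k}. x j = 1)}"

text \<open>Cube coordinates are numbered from 1 and sphere coordinates from 0, hence the shift
  \<open>Suc i\<close>; the last cube coordinate \<open>n + 2\<close> is the reference. The default
  0 is forced, since points of \<open>nsphere n\<close> vanish beyond index
  \<open>n\<close>.\<close>

definition offsets :: "nat \<Rightarrow> (nat \<Rightarrow> real) \<Rightarrow> nat \<Rightarrow> real" where
  "offsets n x = (\<lambda>i. if i \<le> n then x (Suc i) - x (n + 2) else 0)"

definition to_sphere :: "nat \<Rightarrow> (nat \<Rightarrow> real) \<Rightarrow> nat \<Rightarrow> real" where
  "to_sphere n x = (\<lambda>i. offsets n x i / sqrt (\<Sum>j\<le>n. (offsets n x j)\<^sup>2))"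

lemma topspace_cube_topology: "topspace (cube_topology k) = {1..k} \<rightarrow>\<^sub>E {0..1}"
  by (simp add: cube_topology_def)

lemma compact_space_cube_topology: "compact_space (cube_topology k)"
  by (simp add: cube_topology_def compact_space_product_topology compact_space_subtopology)

lemma closedin_cube_face:
  assumes "I \<subseteq> {1..k}" "J \<subseteq> {1..k}"
  shows "closedin (cube_topology k) (cube_face k (I, J))"
proof -
  have proj: "continuous_map (cube_topology k) euclideanreal (\<lambda>x. x i)" if "i \<in> {1..k}" for i
    using continuous_map_product_projection[OF that, of "\<lambda>_. top_of_set {0..1::real}"]
    by (simp add: cube_topology_def continuous_map_in_subtopology)
  have cl: "closedin (cube_topology k) {x \<in> topspace (cube_topology k). x i \<in> {a}}"
    if "i \<in> {1..k}" for i a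
    by (rule closedin_continuous_map_preimage[OF proj[OF that]]) simp
  \<comment> \<open>The whole space is inserted so that the intersected family is nonempty even if
    \<open>I\<close> and \<open>J\<close> are empty.\<close>
  have "cube_face k (I, J) =
    \<Inter>(insert (topspace (cube_topology k))
      ((\<lambda>i. {x \<in> topspace (cube_topology k). x i \<in> {0}}) ` I \<union>
       (\<lambda>j. {x \<in> topspace (cube_topology k). x j \<in> {1}}) ` J))"
    by auto
  also have "closedin (cube_topology k) \<dots>"
    using assms cl by (intro closedin_Inter) auto
  finally show ?thesis .
qed

lemma cube_rim_range:
  "x \<in> cube_rim k \<Longrightarrow> i \<in> {1..k} \<Longrightarrow> 0 \<le> x i \<and> x i \<le> 1"
  by (auto simp: cube_rim_def topspace_cube_topology PiE_iff)

text \<open>If all offsets vanished, \<open>x\<close> would be constant on its coordinates, yet it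
  takes both values 0 and 1. This makes the normalisation in \<open>to_sphere\<close>
  legitimate.\<close>

lemma sum_squares_offsets_pos:
  assumes "x \<in> cube_rim (n + 2)"
  shows "(\<Sum>j\<le>n. (offsets n x j)\<^sup>2) > 0"
proof (rule ccontr)
  assume "\<not> ?thesis"
  then have "(\<Sum>j\<le>n. (offsets n x j)\<^sup>2) = 0"
    by (meson linorder_not_less order_antisym sum_nonneg zero_le_power2)
  then have 0: "x (Suc j) = x (n + 2)" if "j \<le> n" for j
    using that by (auto simp: sum_nonneg_eq_0_iff offsets_def)
  have const: "x i = x (n + 2)" if "i \<in> {1..n + 2}" for i
  proof (cases "i = n + 2")
    case False
    with that obtain j where "i = Suc j" "j \<le> n" by (cases i) auto
    then show ?thesis using 0 by simp
  qed simp
  obtain i j where "i \<in> {1..n+2}" "j \<in> {1..n+2}" "x i = 0" "x j = 1"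
    using assms by (auto simp: cube_rim_def)
  then show False using const[of i] const[of j] by simp
qed

lemma to_sphere_in_nsphere:
  assumes "x \<in> cube_rim (n + 2)"
  shows "to_sphere n x \<in> topspace (nsphere n)"
  using sum_squares_offsets_pos[OF assms]
  by (simp add: nsphere to_sphere_def offsets_def power_divide flip: sum_divide_distrib)

lemma continuous_map_to_sphere:
  "continuous_map (subtopology (cube_topology (n + 2)) (cube_rim (n + 2))) (nsphere n) (to_sphere n)"
    (is "continuous_map ?B _ _")
proof -
  have proj: "continuous_map ?B euclideanreal (\<lambda>x. x i)" if "i \<in> {1..n + 2}" for i
    using continuous_map_product_projection[OF that, of "\<lambda>_. top_of_set {0..1::real}"]
    by (intro continuous_map_from_subtopology)
      (simp add: cube_topology_def continuous_map_in_subtopology)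
  have off: "continuous_map ?B euclideanreal (\<lambda>x. offsets n x i)" for i
    by (cases "i \<le> n") (simp_all add: offsets_def continuous_map_diff proj del: add_2_eq_Suc')
  have "continuous_map ?B euclideanreal (\<lambda>x. to_sphere n x i)" for i
    unfolding to_sphere_def
  proof (intro continuous_map_real_divide continuous_map_sqrt continuous_map_sum
      continuous_map_real_pow off)
    fix x assume "x \<in> topspace ?B"
    then show "sqrt (\<Sum>j\<le>n. (offsets n x j)\<^sup>2) \<noteq> 0"
      using sum_squares_offsets_pos[of x n] by simp
  qed simp
  then have "continuous_map ?B (powertop_real UNIV) (to_sphere n)"
    by (simp add: continuous_map_componentwise_UNIV)
  then show ?thesis
    using to_sphere_in_nsphere by (auto simp: nsphere continuous_map_in_subtopology)
qed

text \<open>Equal images mean that the coordinate differences of \<open>x\<close> and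
  \<open>y\<close> are proportional with a factor \<open>r > 0\<close>. Both points have spread
  exactly 1, which forces \<open>r = 1\<close>; both have minimum 0, which rules out a
  translation.\<close>

lemma inj_on_to_sphere: "inj_on (to_sphere n) (cube_rim (n + 2))"
proof (rule inj_onI)
  let ?K = "{1..n + 2}"
  fix x y assume x: "x \<in> cube_rim (n + 2)" and y: "y \<in> cube_rim (n + 2)"
    and eq: "to_sphere n x = to_sphere n y"
  define r where "r = sqrt (\<Sum>j\<le>n. (offsets n x j)\<^sup>2) / sqrt (\<Sum>j\<le>n. (offsets n y j)\<^sup>2)"
  have r: "r > 0"
    using sum_squares_offsets_pos[OF x] sum_squares_offsets_pos[OF y] by (simp add: r_def)
  have off: "offsets n x i = r * offsets n y i" for i
    using fun_cong[OF eq, of i] sum_squares_offsets_pos[OF x] sum_squares_offsets_pos[OF y]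
    by (simp add: to_sphere_def r_def field_simps)
  have base: "x i - x (n + 2) = r * (y i - y (n + 2))" if "i \<in> ?K" for i
  proof (cases "i = n + 2")
    case False
    with that obtain j where "i = Suc j" "j \<le> n" by (cases i) auto
    then show ?thesis using off[of j] by (simp add: offsets_def)
  qed simp
  have diff: "x i - x j = r * (y i - y j)" if "i \<in> ?K" "j \<in> ?K" for i j
    using base[OF that(1)] base[OF that(2)] by (simp add: algebra_simps)
  obtain i j where ij: "i \<in> ?K" "j \<in> ?K" "x i = 0" "x j = 1"
    using x by (auto simp: cube_rim_def)
  obtain i' j' where ij': "i' \<in> ?K" "j' \<in> ?K" "y i' = 0" "y j' = 1"
    using y by (auto simp: cube_rim_def)
  \<comment> \<open>Comparing the extremes of \<open>x\<close> with the same coordinates of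
    \<open>y\<close> gives \<open>1 \<le> r\<close>; the extremes of \<open>y\<close> give the
    reverse bound.\<close>
  have "1 = r * (y j - y i)"
    using diff[OF ij(2,1)] ij by simp
  also have "\<dots> \<le> r * 1"
    using cube_rim_range[OF y ij(1)] cube_rim_range[OF y ij(2)] r by (intro mult_left_mono) auto
  finally have "1 \<le> r" by simp
  moreover have "r \<le> 1"
    using diff[OF ij'(2,1)] ij' cube_rim_range[OF x ij'(1)] cube_rim_range[OF x ij'(2)] by simp
  ultimately have "r = 1" by simp
  then have shift: "x l = y l + x i'" if "l \<in> ?K" for l
    using diff[OF that ij'(1)] ij' by simp
  have "x i' = 0"
    using shift[OF ij(1)] ij cube_rim_range[OF y ij(1)] cube_rim_range[OF x ij'(1)] by simp
  then have "x l = y l" if "l \<in> ?K" for l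
    using shift[OF that] by simp
  moreover have "x \<in> ?K \<rightarrow>\<^sub>E {0..1}" "y \<in> ?K \<rightarrow>\<^sub>E {0..1}"
    using x y by (simp_all add: cube_rim_def topspace_cube_topology)
  ultimately show "x = y"
    by (meson PiE_ext)
qed

text \<open>A preimage is found by undoing the offsets with reference value 0 and rescaling affinely
  so that the minimum \<open>a\<close> becomes 0 and the maximum \<open>b\<close> becomes 1.\<close>

lemma to_sphere_surjective:
  assumes y: "y \<in> topspace (nsphere n)"
  shows "\<exists>x\<in>cube_rim (n + 2). to_sphere n x = y"
proof -
  let ?K = "{1..n + 2}"
  define w where "w i = (if i = n + 2 then 0 else y (i - 1))" for i
  define a where "a = Min (w ` ?K)"
  define b where "b = Max (w ` ?K)"
  define x where "x = (\<lambda>i\<in>?K. (w i - a) / (b - a))"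
  have ab: "a \<le> w i" "w i \<le> b" if "i \<in> ?K" for i
    using that by (auto simp: a_def b_def)
  have "a \<in> w ` ?K" "b \<in> w ` ?K"
    unfolding a_def b_def by (intro Min_in Max_in; simp)+
  then obtain i j where ij: "i \<in> ?K" "w i = a" "j \<in> ?K" "w j = b"
    by blast
  have y1: "(\<Sum>i\<le>n. (y i)\<^sup>2) = 1" and y0: "\<And>i. i > n \<Longrightarrow> y i = 0"
    using y by (auto simp: nsphere)
  \<comment> \<open>Otherwise \<open>w\<close> is constant, equal to its reference value 0, and
    \<open>y\<close> could not have norm 1.\<close>
  have "a < b"
  proof (rule ccontr)
    assume "\<not> a < b"
    then have const: "w i = w (n + 2)" if "i \<in> ?K" for i
      using ab[OF that] ab[of "n + 2"] by simp
    have "y i = 0" if "i \<le> n" for i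
      using const[of "Suc i"] that by (simp add: w_def)
    then show False using y1 by simp
  qed
  have "x \<in> cube_rim (n + 2)"
  proof -
    have "x \<in> topspace (cube_topology (n + 2))"
      using ab \<open>a < b\<close> by (auto simp: topspace_cube_topology x_def divide_simps)
    moreover have "x i = 0" "x j = 1"
      using ij \<open>a < b\<close> by (auto simp: x_def)
    ultimately show ?thesis
      using ij by (auto simp: cube_rim_def)
  qed
  moreover have "to_sphere n x = y"
  proof -
    have off: "offsets n x i = y i / (b - a)" for i
      using y0[of i] by (auto simp: offsets_def x_def w_def diff_divide_distrib)
    \<comment> \<open>As \<open>b - a\<close> is positive, the norm of the offsets is
      \<open>1 / (b - a)\<close>, and normalising cancels the scaling.\<close>
    have "(\<Sum>j\<le>n. (offsets n x j)\<^sup>2) = (1 / (b - a))\<^sup>2"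
      by (simp add: off power_divide y1 flip: sum_divide_distrib)
    then show ?thesis
      using \<open>a < b\<close> by (auto simp: to_sphere_def off real_sqrt_divide)
  qed
  ultimately show ?thesis by blast
qed

lemma cube_reflect_in_cube_rim: "x \<in> cube_rim k \<Longrightarrow> cube_reflect k x \<in> cube_rim k"
  by (fastforce simp: cube_rim_def topspace_cube_topology cube_reflect_def)

lemma cube_reflect_cube_reflect:
  "x \<in> topspace (cube_topology k) \<Longrightarrow> cube_reflect k (cube_reflect k x) = x"
  by (force simp: topspace_cube_topology cube_reflect_def PiE_iff extensional_def)

lemma to_sphere_cube_reflect:
  "to_sphere n (cube_reflect (n + 2) x) = (\<lambda>i. - to_sphere n x i)"
proof -
  have "offsets n (cube_reflect (n + 2) x) = (\<lambda>i. - offsets n x i)"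
    by (auto simp: offsets_def cube_reflect_def)
  then show ?thesis by (simp add: to_sphere_def)
qed


section \<open>The gluing\<close>

text \<open>The pair is kept ordered because its agreement with the chosen ordering decides whether
  a gluing is direct or reflects.\<close>

definition zero_one_pair :: "nat \<Rightarrow> (nat \<Rightarrow> real) \<Rightarrow> nat set \<times> nat set" where
  "zero_one_pair k x = ({i \<in> {1..k}. x i = 0}, {i \<in> {1..k}. x i = 1})"

lemma finite_disjoint_supports: "finite (disjoint_supports k)"
proof (rule finite_subset)
  show "disjoint_supports k \<subseteq> insert None (Some ` Pow (Pow {1..k}))"
    by (auto simp: disjoint_supports_def)
qed simp

lemma is_orderingD:
  assumes "is_ordering k c" "X \<in> disjoint_supports k - {None}" "c X = (I, J)"
  shows "X = Some {I, J}" "I \<noteq> {}" "J \<noteq> {}" "I \<subseteq> {1..k}" "J \<subseteq> {1..k}"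
proof -
  show X: "X = Some {I, J}"
    using assms(1)[unfolded is_ordering_def, rule_format, OF assms(2)] assms(3) by simp
  obtain I' J' where "X = Some {I', J'}" "I' \<noteq> {}" "J' \<noteq> {}"
    using assms(2) unfolding disjoint_supports_def by blast
  with X show "I \<noteq> {}" "J \<noteq> {}"
    by (auto simp: doubleton_eq_iff)
  show "I \<subseteq> {1..k}" "J \<subseteq> {1..k}"
    using is_ordering_subset[OF assms] .
qed

lemma topspace_disjoint_cubes:
  "topspace (disjoint_cubes k c) =
     (SIGMA X:disjoint_supports k - {None}. topspace (cube_topology k) \<inter> cube_face k (c X))"
  by (auto simp: disjoint_cubes_def)

lemma cube_face_subset_cube_rim:
  assumes "is_ordering k c" "X \<in> disjoint_supports k - {None}"
  shows "cube_face k (c X) \<subseteq> cube_rim k"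
proof -
  obtain I J where IJ: "c X = (I, J)" by fastforce
  show ?thesis
    using is_orderingD[OF assms IJ] unfolding IJ by (fastforce simp: cube_rim_def)
qed

lemma disjoint_cubes_in_cube_rim:
  assumes "is_ordering k c" "p \<in> topspace (disjoint_cubes k c)"
  shows "snd p \<in> cube_rim k"
proof -
  have "fst p \<in> disjoint_supports k - {None}" "snd p \<in> cube_face k (c (fst p))"
    using assms(2) by (auto simp: topspace_disjoint_cubes)
  then show ?thesis
    using cube_face_subset_cube_rim[OF assms(1)] by blast
qed

lemma compact_space_disjoint_cubes:
  assumes c: "is_ordering k c"
  shows "compact_space (disjoint_cubes k c)"
  unfolding disjoint_cubes_def
proof (rule compact_space_sum_topology)
  fix X assume X: "X \<in> disjoint_supports k - {None}"
  obtain I J where IJ: "c X = (I, J)" by fastforce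
  have "closedin (cube_topology k) (cube_face k (c X))"
    unfolding IJ using is_orderingD[OF c X IJ] by (intro closedin_cube_face)
  then show "compact_space (subtopology (cube_topology k) (cube_face k (c X)))"
    by (intro compact_space_subtopology closedin_compact_space compact_space_cube_topology)
qed (simp add: finite_disjoint_supports)

lemma zero_one_pair_cube_reflect:
  "zero_one_pair k (cube_reflect k x) = prod.swap (zero_one_pair k x)"
  by (auto simp: zero_one_pair_def cube_reflect_def)

lemma zero_one_pair_in_disjoint_supports:
  assumes "x \<in> cube_rim k" "zero_one_pair k x = (R, T)"
  shows "Some {R, T} \<in> disjoint_supports k - {None}"
proof -
  have RT: "R = {i \<in> {1..k}. x i = 0}" "T = {i \<in> {1..k}. x i = 1}"
    using assms(2) by (auto simp: zero_one_pair_def)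
  have "R \<noteq> {}" "T \<noteq> {}" "R \<inter> T = {}" "R \<subseteq> {1..k}" "T \<subseteq> {1..k}"
    using assms(1) by (auto simp: RT cube_rim_def)
  \<comment> \<open>Each set is proper because it misses the other, which is nonempty.\<close>
  then have "R \<noteq> {}" "T \<noteq> {}" "R \<subset> {1..k}" "T \<subset> {1..k}" "R \<inter> T = {}"
    by blast+
  then show ?thesis unfolding disjoint_supports_def by blast
qed

text \<open>
  Depending on the chosen ordering, the minimal cube of \<open>x\<close> contains \<open>x\<close> itself or its reflection;
  \<open>z\<close> is whichever fits.
\<close>

lemma minimal_cube_exists:
  assumes c: "is_ordering k c" and x: "x \<in> cube_rim k"
  obtains z R T where "z = x \<or> z = cube_reflect k x" "zero_one_pair k z = (R, T)"
    "Some {R, T} \<in> disjoint_supports k - {None}" "c (Some {R, T}) = (R, T)"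
proof -
  obtain A B where AB: "zero_one_pair k x = (A, B)" by fastforce
  have Z: "Some {A, B} \<in> disjoint_supports k - {None}"
    using zero_one_pair_in_disjoint_supports[OF x AB] .
  obtain R T where RT: "c (Some {A, B}) = (R, T)" by fastforce
  have eq: "{R, T} = {A, B}"
    using is_orderingD(1)[OF c Z RT] by simp
  then have "R = A \<and> T = B \<or> R = B \<and> T = A"
    by (auto simp: doubleton_eq_iff)
  then obtain z where "z = x \<or> z = cube_reflect k x" "zero_one_pair k z = (R, T)"
    using AB zero_one_pair_cube_reflect[of k x] by force
  then show thesis
    using that Z RT eq by simp
qed

text \<open>A cube containing \<open>x\<close> prescribes zeros and ones only where \<open>x\<close>
  has them, so its pair lies above the pair of the zero set and the one set of \<open>x\<close>.
  Thus every copy of \<open>x\<close> is one gluing step away from its minimal cube.\<close>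

lemma glue_from_minimal_cube:
  assumes c: "is_ordering k c" and p: "(X, x) \<in> topspace (disjoint_cubes k c)"
    and z: "z = x \<or> z = cube_reflect k x"
    and RT: "zero_one_pair k z = (R, T)" and cZ: "c (Some {R, T}) = (R, T)"
  shows "glue k c (Some {R, T}, z) (X, x)"
proof -
  have X: "X \<in> disjoint_supports k - {None}" and x: "x \<in> cube_face k (c X)"
    using p by (auto simp: topspace_disjoint_cubes)
  have xrim: "x \<in> cube_rim k"
    using x cube_face_subset_cube_rim[OF c X] by blast
  then have zrim: "z \<in> cube_rim k"
    using z cube_reflect_in_cube_rim by blast
  have Z: "Some {R, T} \<in> disjoint_supports k - {None}"
    using zero_one_pair_in_disjoint_supports[OF zrim RT] .
  have zface: "z \<in> cube_face k (R, T)"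
    using RT zrim by (auto simp: zero_one_pair_def cube_rim_def)
  obtain I J where IJ: "c X = (I, J)" by fastforce
  note I = is_orderingD[OF c X IJ]
  have sub: "I \<subseteq> fst (zero_one_pair k x)" "J \<subseteq> snd (zero_one_pair k x)"
    using I(4,5) x unfolding IJ by (auto simp: zero_one_pair_def)
  show ?thesis
  proof (cases "z = x")
    case True
    then have "I \<subseteq> R" "J \<subseteq> T" using sub RT by auto
    then have "Some {R, T} \<preceq> X" using I(1) unfolding supports_le_def by blast
    then show ?thesis
      using glue.same[OF Z X _ cZ IJ \<open>I \<subseteq> R\<close> \<open>J \<subseteq> T\<close> zface] True by simp
  next
    case False
    then have zr: "z = cube_reflect k x" using z by simp
    then have "J \<subseteq> R" "I \<subseteq> T" using sub RT by (auto simp: zero_one_pair_cube_reflect prod.swap_def)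
    moreover have "X = Some {J, I}" using I(1) by (simp add: insert_commute)
    ultimately have "Some {R, T} \<preceq> X" unfolding supports_le_def by blast
    moreover have "x = cube_reflect k z"
      using cube_reflect_cube_reflect xrim by (simp add: zr cube_rim_def)
    ultimately show ?thesis
      using glue.swap[OF Z X _ cZ IJ \<open>J \<subseteq> R\<close> \<open>I \<subseteq> T\<close> zface] by simp
  qed
qed

text \<open>Each generator preserves the point up to reflection, and reflection is an involution, so
  chains do too. Conversely, two copies of a point or its reflection are both glued to the same
  point of the minimal cube.\<close>

lemma generated_equiv_glue_iff:
  assumes c: "is_ordering k c"
    and p: "p \<in> topspace (disjoint_cubes k c)" and q: "q \<in> topspace (disjoint_cubes k c)"
  shows "(p, q) \<in> generated_equiv (topspace (disjoint_cubes k c)) (glue k c)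
     \<longleftrightarrow> snd q = snd p \<or> snd q = cube_reflect k (snd p)" (is "?L \<longleftrightarrow> ?R")
proof
  have invol: "cube_reflect k (cube_reflect k (snd a)) = snd a"
    if "a \<in> topspace (disjoint_cubes k c)" for a
    using that by (auto simp: topspace_disjoint_cubes cube_reflect_cube_reflect)
  assume ?L
  then have "equivclp (\<lambda>a b. a \<in> topspace (disjoint_cubes k c) \<and>
      b \<in> topspace (disjoint_cubes k c) \<and> glue k c a b) p q"
    by (simp add: generated_equiv_def)
  then show ?R
  proof (induction rule: equivclp_induct)
    case (step y z)
    have link: "snd b = snd a \<or> snd b = cube_reflect k (snd a)" if "glue k c a b" for a b
      using that by cases auto
    \<comment> \<open>A link of the closure may run backwards; the involution then turns it
      around.\<close>
    have "snd z = snd y \<or> snd z = cube_reflect k (snd y)"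
      using step.hyps(2) link[of y z] link[of z y] invol[of z] by auto
    then show ?case
      using step.IH invol[OF p] by auto
  qed simp
next
  assume R: ?R
  obtain X x Y y where XY: "p = (X, x)" "q = (Y, y)" by fastforce
  have xrim: "x \<in> cube_rim k"
    using disjoint_cubes_in_cube_rim[OF c p] XY by simp
  have yx: "y = x \<or> y = cube_reflect k x"
    using R XY by simp
  obtain z R T where z: "z = x \<or> z = cube_reflect k x" "zero_one_pair k z = (R, T)"
    and cZ: "c (Some {R, T}) = (R, T)"
    using minimal_cube_exists[OF c xrim] .
  have zy: "z = y \<or> z = cube_reflect k y"
    using z(1) yx xrim by (auto simp: cube_rim_def cube_reflect_cube_reflect)
  have "glue k c (Some {R, T}, z) p" "glue k c (Some {R, T}, z) q"
    using glue_from_minimal_cube[OF c _ _ z(2) cZ] p q z(1) zy XY by auto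
  \<comment> \<open>The zigzag has two links: from \<open>p\<close> back to the minimal cube, then
    forward to \<open>q\<close>.\<close>
  then have "equivclp (\<lambda>a b. a \<in> topspace (disjoint_cubes k c) \<and>
      b \<in> topspace (disjoint_cubes k c) \<and> glue k c a b) p q"
    using glue_in_topspace[OF c]
    by (intro equivclp_trans[OF converse_r_into_equivclp[of _ "(Some {R, T}, z)"]
          r_into_equivclp]) simp_all
  with p q show ?L by (simp add: generated_equiv_def)
qed

section \<open>The comparison map from the disjoint cubes onto projective space\<close>

lemma continuous_map_disjoint_cubes_nsphere:
  assumes c: "is_ordering (n + 2) c"
  shows "continuous_map (disjoint_cubes (n + 2) c) (nsphere n) (\<lambda>p. to_sphere n (snd p))"
  unfolding disjoint_cubes_def
proof (rule continuous_map_from_sum_topology)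
  fix X assume "X \<in> disjoint_supports (n + 2) - {None}"
  then show "continuous_map (subtopology (cube_topology (n + 2)) (cube_face (n + 2) (c X)))
      (nsphere n) (\<lambda>x. to_sphere n (snd (X, x)))"
    using continuous_map_from_subtopology_mono[OF continuous_map_to_sphere]
      cube_face_subset_cube_rim[OF c] by simp
qed

text \<open>A continuous closed surjection is a quotient map. Closedness of the map to the sphere
  comes from compactness of the finite union of cubes and the Hausdorff property of the
  sphere.\<close>

lemma quotient_map_disjoint_cubes_projective_space:
  assumes c: "is_ordering (n + 2) c"
  shows "quotient_map (disjoint_cubes (n + 2) c) (real_projective_space n)
    (\<lambda>p. antipodal_rel n `` {to_sphere n (snd p)})"
    (is "quotient_map ?D ?P ?g")
proof (rule continuous_closed_imp_quotient_map)
  let ?f = "\<lambda>p::nat set set option \<times> (nat \<Rightarrow> real). to_sphere n (snd p)"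
  let ?q = "\<lambda>x. antipodal_rel n `` {x}"
  have q: "quotient_map (nsphere n) ?P ?q"
    unfolding real_projective_space_def
    by (rule quotient_map_quotient_topology[OF equiv_antipodal_rel])
  have f: "continuous_map ?D (nsphere n) ?f"
    using continuous_map_disjoint_cubes_nsphere[OF c] .
  have g: "?g = ?q \<circ> ?f" by (simp add: o_def)
  show "continuous_map ?D ?P ?g"
    unfolding g using f quotient_imp_continuous_map[OF q] by (rule continuous_map_compose)
  have "Hausdorff_space (nsphere n)"
    unfolding nsphere_def by (intro Hausdorff_space_subtopology Hausdorff_Euclidean_space)
  then have "closed_map ?D (nsphere n) ?f"
    using f compact_space_disjoint_cubes[OF c] by (intro continuous_imp_closed_map)
  then show "closed_map ?D ?P ?g"
    unfolding g using closed_map_antipodal by (rule closed_map_compose)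
  show "?g ` topspace ?D = topspace ?P"
  proof
    show "?g ` topspace ?D \<subseteq> topspace ?P"
      using \<open>continuous_map ?D ?P ?g\<close> by (rule continuous_map_image_subset_topspace)
    show "topspace ?P \<subseteq> ?g ` topspace ?D"
    proof
      fix u assume "u \<in> topspace ?P"
      then obtain y where y: "y \<in> topspace (nsphere n)" "u = ?q y"
        using quotient_imp_surjective_map[OF q] by blast
      obtain x where x: "x \<in> cube_rim (n + 2)" "to_sphere n x = y"
        using to_sphere_surjective[OF y(1)] by blast
      \<comment> \<open>The chosen ordering may provide a cube only for the reflection of
        \<open>x\<close>; it maps to the antipode of \<open>y\<close>, which has the same class
        \<open>u\<close>.\<close>
      obtain z R T where z: "z = x \<or> z = cube_reflect (n + 2) x" "zero_one_pair (n + 2) z = (R, T)"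
        and Z: "Some {R, T} \<in> disjoint_supports (n + 2) - {None}" and cZ: "c (Some {R, T}) = (R, T)"
        using minimal_cube_exists[OF c x(1)] .
      have "z \<in> topspace (cube_topology (n + 2))"
        using z(1) x(1) cube_reflect_in_cube_rim[OF x(1)] by (auto simp: cube_rim_def)
      then have "(Some {R, T}, z) \<in> topspace ?D"
        using Z cZ z(2) by (auto simp: topspace_disjoint_cubes zero_one_pair_def)
      moreover have "?g (Some {R, T}, z) = u"
        using z(1)
      proof
        assume "z = cube_reflect (n + 2) x"
        then have "to_sphere n z = (\<lambda>i. - y i)"
          using to_sphere_cube_reflect x(2) by simp
        then show ?thesis
          using antipodal_class_eq_iff[OF y(1) nsphere_uminus[OF y(1)]] y(2) by simp
      qed (simp add: x(2) y(2))
      ultimately show "u \<in> ?g ` topspace ?D" by blast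
    qed
  qed
qed

theorem corollary4p6:
  fixes k :: nat
    and c :: "nat set set option \<Rightarrow> nat set \<times> nat set"
  assumes "k \<ge> 2"
    and "is_ordering k c"
  shows "disjoint_supports_space k c homeomorphic_space real_projective_space (k - 2)"
proof -
  define n where "n = k - 2"
  have k: "k = n + 2" using assms(1) by (simp add: n_def)
  note c = assms(2)[unfolded k]
  let ?D = "disjoint_cubes (n + 2) c"
  let ?E = "generated_equiv (topspace ?D) (glue (n + 2) c)"
  have "disjoint_supports_space (n + 2) c homeomorphic_space real_projective_space n"
  \<comment> \<open>Both spaces are quotients of the disjoint cubes, so it remains to compare the
    fibres: points equal up to reflection on one side, antipodal classes on the other.\<close>
  proof (rule quotient_maps_same_fibres_imp_homeomorphic_space)
    show "quotient_map ?D (disjoint_supports_space (n + 2) c) (\<lambda>p. ?E `` {p})"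
      unfolding disjoint_supports_space_def
      by (rule quotient_map_quotient_topology[OF equiv_generated_equiv])
    show "quotient_map ?D (real_projective_space n) (\<lambda>p. antipodal_rel n `` {to_sphere n (snd p)})"
      using quotient_map_disjoint_cubes_projective_space[OF c] .
    fix p q assume p: "p \<in> topspace ?D" and q: "q \<in> topspace ?D"
    have rim: "snd p \<in> cube_rim (n + 2)" "snd q \<in> cube_rim (n + 2)"
      using disjoint_cubes_in_cube_rim[OF c] p q by blast+
    have "?E `` {p} = ?E `` {q} \<longleftrightarrow> snd q = snd p \<or> snd q = cube_reflect (n + 2) (snd p)"
      using eq_equiv_class_iff[OF equiv_generated_equiv p q] generated_equiv_glue_iff[OF c p q]
      by simp
    also have "\<dots> \<longleftrightarrow> to_sphere n (snd q) = to_sphere n (snd p) \<or>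
        to_sphere n (snd q) = to_sphere n (cube_reflect (n + 2) (snd p))"
      using inj_on_eq_iff[OF inj_on_to_sphere] rim cube_reflect_in_cube_rim by metis
    also have "\<dots> \<longleftrightarrow> antipodal_rel n `` {to_sphere n (snd p)} = antipodal_rel n `` {to_sphere n (snd q)}"
      using rim by (simp only: antipodal_class_eq_iff to_sphere_in_nsphere to_sphere_cube_reflect)
    finally show "?E `` {p} = ?E `` {q} \<longleftrightarrow>
        antipodal_rel n `` {to_sphere n (snd p)} = antipodal_rel n `` {to_sphere n (snd q)}" .
  qed
  then show ?thesis by (simp add: k)
qed

end
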